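(* Let $g\ge2$ and $q$ be positive integers, and let $\#\mathcal F(g,q,3)$ denote the number of gapsets of genus $g$, depth $q$ and multiplicity $3$. Then $$\#\mathcal F(g,q,3)=\begin{cases}0, & \text{if } q<\frac g2,\\ 1, & \text{if } q=\frac g2,\\ 2, & \text{if } \frac{g+1}{2}\le q\le\frac{2g}{3},\\ 1, & \text{if } q=\frac{2g+1}{3},\\ 0, & \text{if } q>\frac{2g+1}{3}.\end{cases}$$
   Context: A gapset is a finite set $G\subset\mathbb N$ (positive integers) such that whenever $z\in G$ and $z=x+y$ with $x,y\in\mathbb N$, then $x\in G$ or $y\in G$. Its genus is $\#G$, its multiplicity is $m(G)=\min\{s\in\mathbb N_0\setminus G: s\ne0\}$, its conductor is $c(G)=\min\{s\in\mathbb N_0: s+n\notin G\ \forall n\in\mathbb N_0\}$, and its depth is $\lceil c(G)/m(G)\rceil$. *)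

theory Defs
  imports Complex_Main
begin

text \<open>Type \<open>nat\<close> contains 0, so the positivity of the elements of a gapset and of the
  summands \<open>x\<close>, \<open>y\<close> is stated explicitly.\<close>

definition gapset :: "nat set \<Rightarrow> bool" where
  "gapset G \<longleftrightarrow> finite G \<and> (\<forall>z\<in>G. 0 < z) \<and>
     (\<forall>z\<in>G. \<forall>x y. 0 < x \<longrightarrow> 0 < y \<longrightarrow> z = x + y \<longrightarrow> x \<in> G \<or> y \<in> G)"

definition genus :: "nat set \<Rightarrow> nat" where
  "genus G = card G"

definition multiplicity :: "nat set \<Rightarrow> nat" where
  "multiplicity G = (LEAST s. s \<noteq> 0 \<and> s \<notin> G)"

definition conductor :: "nat set \<Rightarrow> nat" where
  "conductor G = (LEAST s. \<forall>n. s + n \<notin> G)"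

definition depth :: "nat set \<Rightarrow> int" where
  "depth G = \<lceil>real (conductor G) / real (multiplicity G)\<rceil>"

definition gapsets :: "nat \<Rightarrow> nat \<Rightarrow> nat \<Rightarrow> nat set set" where
  "gapsets g q m = {G. gapset G \<and> genus G = g \<and> depth G = int q \<and> multiplicity G = m}"

end

theory Submission
  imports Defs
begin

text \<open>
  A gapset of multiplicity 3 consists of the first \<open>a\<close> numbers congruent to 1 and the first \<open>b\<close>
  numbers congruent to 2 modulo 3, with \<open>a, b \<ge> 1\<close>. Only the splittings of an
  element of one class into two summands of the other class matter; they turn the gapset
  condition into \<open>b \<le> 2 a\<close> and \<open>a \<le> 2 b + 1\<close>. The genus is \<open>a + b\<close> and the depth is \<open>max a b\<close>, so for given
  genus and depth only the pairs \<open>(q, g - q)\<close> and \<open>(g - q, q)\<close> are possible.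
\<close>

text \<open>When this set is a gapset, \<open>a\<close> and \<open>b\<close> are the Kunz
  coordinates with respect to 3 of the complementary numerical semigroup: \<open>3 * a + 1\<close>
  and \<open>3 * b + 2\<close> are its least elements in their residue classes.\<close>

definition kunz_gaps :: "nat \<Rightarrow> nat \<Rightarrow> nat set" where
  "kunz_gaps a b = (\<lambda>i. 3 * i + 1) ` {..<a} \<union> (\<lambda>i. 3 * i + 2) ` {..<b}"

lemma mem_kunz_gaps:
  "n \<in> kunz_gaps a b \<longleftrightarrow> (\<exists>i<a. n = 3 * i + 1) \<or> (\<exists>i<b. n = 3 * i + 2)"
  by (auto simp: kunz_gaps_def)

lemma mem_kunz_gaps_add [simp]:
  "3 * i + 1 \<in> kunz_gaps a b \<longleftrightarrow> i < a"
  "3 * i + 2 \<in> kunz_gaps a b \<longleftrightarrow> i < b"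
  "3 * i \<notin> kunz_gaps a b"
proof -
  have "3 * i + 1 \<noteq> 3 * j + 2" "3 * i + 2 \<noteq> 3 * j + 1" "3 * i \<noteq> 3 * j + 1" "3 * i \<noteq> 3 * j + 2"
    for i j :: nat
    by arith+
  then show "3 * i + 1 \<in> kunz_gaps a b \<longleftrightarrow> i < a" "3 * i + 2 \<in> kunz_gaps a b \<longleftrightarrow> i < b"
    "3 * i \<notin> kunz_gaps a b"
    unfolding mem_kunz_gaps by (metis add_right_cancel mult_left_cancel zero_neq_numeral)+
qed

lemma finite_kunz_gaps [simp]: "finite (kunz_gaps a b)"
  by (simp add: kunz_gaps_def)

lemma card_kunz_gaps: "card (kunz_gaps a b) = a + b"
proof -
  have "(\<lambda>i. 3 * i + 1) ` {..<a} \<inter> (\<lambda>i. 3 * i + 2) ` {..<b} = ({} :: nat set)"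
    by (auto, presburger)
  then show ?thesis
    unfolding kunz_gaps_def by (subst card_Un_disjoint) (auto simp: card_image inj_on_def)
qed

text \<open>Each residue class of the set recovers its own coordinate. This injectivity lets the
  final count treat different pairs as different gapsets.\<close>

lemma kunz_gaps_eq_iff [simp]: "kunz_gaps a b = kunz_gaps c d \<longleftrightarrow> a = c \<and> b = d"
proof
  assume eq: "kunz_gaps a b = kunz_gaps c d"
  have "i < a \<longleftrightarrow> i < c" "i < b \<longleftrightarrow> i < d" for i
    using eq mem_kunz_gaps_add by metis+
  then show "a = c \<and> b = d"
    by (meson linorder_neq_iff)
qed simp

lemma multiplicity_kunz_gaps: "multiplicity (kunz_gaps a b) = 3" if "1 \<le> a" "1 \<le> b"
  unfolding multiplicity_def
proof (rule Least_equality)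
  show "3 \<noteq> (0::nat) \<and> 3 \<notin> kunz_gaps a b"
    using mem_kunz_gaps_add(3)[of 1 a b] by simp
next
  fix s assume s: "s \<noteq> 0 \<and> s \<notin> kunz_gaps a b"
  show "3 \<le> s"
  proof (rule ccontr)
    assume "\<not> 3 \<le> s"
    with s have "s = 1 \<or> s = 2" by linarith
    with s that show False by (auto simp: mem_kunz_gaps)
  qed
qed

text \<open>The conductor is one more than the largest gap, and the last gaps of the two classes are
  \<open>3 * (a - 1) + 1\<close> and \<open>3 * (b - 1) + 2\<close>.\<close>

lemma conductor_kunz_gaps:
  assumes "1 \<le> a" "1 \<le> b"
  shows "conductor (kunz_gaps a b) = max (3 * a - 1) (3 * b)"
  unfolding conductor_def
proof (rule Least_equality)
  show "\<forall>n. max (3 * a - 1) (3 * b) + n \<notin> kunz_gaps a b"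
  proof
    fix n
    have "3 * a - 1 \<le> max (3 * a - 1) (3 * b) + n" "3 * b \<le> max (3 * a - 1) (3 * b) + n"
      by simp_all
    then show "max (3 * a - 1) (3 * b) + n \<notin> kunz_gaps a b"
      using assms unfolding mem_kunz_gaps by force
  qed
next
  fix s assume s: "\<forall>n. s + n \<notin> kunz_gaps a b"
  have bound: "z < s" if "z \<in> kunz_gaps a b" for z
    using s that by (metis le_add_diff_inverse not_le)
  have "3 * (a - 1) + 1 < s" "3 * (b - 1) + 2 < s"
    using assms by (intro bound; simp only: mem_kunz_gaps_add; simp)+
  then show "max (3 * a - 1) (3 * b) \<le> s"
    using assms by linarith
qed

text \<open>Dividing the conductor by 3 gives a - 1/3 if a > b and b otherwise; rounding up gives
  the larger coordinate in both cases.\<close>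

lemma depth_kunz_gaps:
  assumes "1 \<le> a" "1 \<le> b"
  shows "depth (kunz_gaps a b) = int (max a b)"
  unfolding depth_def multiplicity_kunz_gaps[OF assms] conductor_kunz_gaps[OF assms]
  using assms by (intro ceiling_unique) (auto simp: max_def)

lemma gapset_kunz_gaps_iff: "gapset (kunz_gaps a b) \<longleftrightarrow> b \<le> 2 * a \<and> a \<le> 2 * b + 1"
proof
  assume "gapset (kunz_gaps a b)"
  then have split: "x \<in> kunz_gaps a b \<or> y \<in> kunz_gaps a b"
    if "x + y \<in> kunz_gaps a b" "0 < x" "0 < y" for x y
    using that by (auto simp: gapset_def)
  have "b \<le> 2 * a"
  proof (rule ccontr)
    assume "\<not> b \<le> 2 * a"
    \<comment> \<open>This gap is twice \<open>3 * a + 1\<close>, the first non-gap congruent to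
      1.\<close>
    then have "3 * (2 * a) + 2 \<in> kunz_gaps a b"
      by (simp only: mem_kunz_gaps_add)
    moreover have "3 * (2 * a) + 2 = (3 * a + 1) + (3 * a + 1)"
      by simp
    ultimately have "3 * a + 1 \<in> kunz_gaps a b"
      using split[of "3 * a + 1" "3 * a + 1"] by (metis add_gr_0 zero_less_one)
    then show False
      by (simp only: mem_kunz_gaps_add)
  qed
  moreover have "a \<le> 2 * b + 1"
  proof (rule ccontr)
    assume "\<not> a \<le> 2 * b + 1"
    \<comment> \<open>Twice the first non-gap congruent to 2; the carry 2 + 2 = 3 + 1 produces the
      extra 1 in the bound on \<open>a\<close>.\<close>
    then have "3 * (2 * b + 1) + 1 \<in> kunz_gaps a b"
      by (simp only: mem_kunz_gaps_add)
    moreover have "3 * (2 * b + 1) + 1 = (3 * b + 2) + (3 * b + 2)"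
      by simp
    ultimately have "3 * b + 2 \<in> kunz_gaps a b"
      using split[of "3 * b + 2" "3 * b + 2"] by (metis add_gr_0 zero_less_numeral)
    then show False
      by (simp only: mem_kunz_gaps_add)
  qed
  ultimately show "b \<le> 2 * a \<and> a \<le> 2 * b + 1" ..
next
  assume ab: "b \<le> 2 * a \<and> a \<le> 2 * b + 1"
  have "x \<in> kunz_gaps a b \<or> y \<in> kunz_gaps a b" if "x + y \<in> kunz_gaps a b" for x y
  proof -
    define i j where "i = x div 3" and "j = y div 3"
    have x: "x = 3 * i \<or> x = 3 * i + 1 \<or> x = 3 * i + 2"
      and y: "y = 3 * j \<or> y = 3 * j + 1 \<or> y = 3 * j + 2"
      unfolding i_def j_def by presburger+
    \<comment> \<open>All nine residue combinations. If one summand is a multiple of 3, the other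
      lies in the class of the sum, at or below it. For 1 + 1, i + j < b \<le> 2a forces i < a or j
      < a; for 2 + 2, i + j + 1 < a \<le> 2b + 1 forces i < b or j < b. The remaining sums are
      multiples of 3, hence not gaps.\<close>
    have sums: "3 * i + 3 * j = 3 * (i + j)"
      "3 * i + (3 * j + 1) = 3 * (i + j) + 1" "3 * i + (3 * j + 2) = 3 * (i + j) + 2"
      "3 * i + 1 + 3 * j = 3 * (i + j) + 1" "3 * i + 2 + 3 * j = 3 * (i + j) + 2"
      "3 * i + 1 + (3 * j + 1) = 3 * (i + j) + 2" "3 * i + 2 + (3 * j + 2) = 3 * (i + j + 1) + 1"
      "3 * i + 1 + (3 * j + 2) = 3 * (i + j + 1)" "3 * i + 2 + (3 * j + 1) = 3 * (i + j + 1)"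
      by simp_all
    show ?thesis
      using x y that ab by (elim disjE; simp only: sums mem_kunz_gaps_add; linarith)
  qed
  then show "gapset (kunz_gaps a b)"
    using mem_kunz_gaps_add(3)[of 0 a b] by (auto simp: gapset_def intro: gr0I)
qed

text \<open>Finiteness provides a least non-member \<open>n\<close>, and downward closure propagates
  non-membership from \<open>n\<close> to everything above it.\<close>

lemma finite_down_closed_eq_lessThan:
  fixes A :: "nat set"
  assumes "finite A" and "\<And>i. Suc i \<in> A \<Longrightarrow> i \<in> A"
  obtains n where "A = {..<n}"
proof
  define n where "n = (LEAST i. i \<notin> A)"
  have "n \<notin> A"
    unfolding n_def using ex_new_if_finite[OF infinite_UNIV_nat assms(1)] by (rule LeastI_ex)
  then have "n + k \<notin> A" for k
    by (induction k) (auto dest: assms(2))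
  moreover have "i \<in> A" if "i < n" for i
    using that not_less_Least unfolding n_def by blast
  ultimately show "A = {..<n}"
    by (auto simp: not_less dest: le_Suc_ex) (metis le_Suc_ex not_less)
qed

lemma gapset_multiplicity_3E:
  assumes "gapset G" and mult: "multiplicity G = 3"
  obtains a b where "1 \<le> a" "1 \<le> b" "G = kunz_gaps a b"
proof -
  have fin: "finite G" and "0 \<notin> G"
    and split: "\<And>x y. x + y \<in> G \<Longrightarrow> 0 < x \<Longrightarrow> 0 < y \<Longrightarrow> x \<in> G \<or> y \<in> G"
    using assms(1) by (auto simp: gapset_def)
  \<comment> \<open>A witness is required before the \<open>LEAST\<close> in the multiplicity says
    anything; adding 0 to \<open>G\<close> makes the fresh element nonzero.\<close>
  have "\<exists>s. s \<noteq> 0 \<and> s \<notin> G"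
    using ex_new_if_finite[OF infinite_UNIV_nat, of "insert 0 G"] fin by auto
  then have "3 \<notin> G"
    using LeastI_ex[of "\<lambda>s. s \<noteq> 0 \<and> s \<notin> G"] mult by (simp add: multiplicity_def)
  have small: "s \<in> G" if "0 < s" "s < 3" for s
    using not_less_Least[of s "\<lambda>s. s \<noteq> 0 \<and> s \<notin> G"] that mult by (auto simp: multiplicity_def)
  \<comment> \<open>Since 3 is not a gap, splitting \<open>x + 3\<close> leaves only
    \<open>x\<close>; hence each residue class of \<open>G\<close> is an initial segment.\<close>
  have down: "x \<in> G" if "x + 3 \<in> G" for x
    using split[of x 3] that \<open>3 \<notin> G\<close> by (cases "x = 0") auto
  have "3 * i \<notin> G" for i
  proof (induction i)
    case (Suc i)
    then show ?case using down[of "3 * i"] by (auto simp: add.commute)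
  qed (simp add: \<open>0 \<notin> G\<close>)
  have initial: "\<exists>n. {i. 3 * i + r \<in> G} = {..<n}" for r
  proof (rule finite_down_closed_eq_lessThan)
    have "finite ((\<lambda>i. 3 * i + r) -` G)"
      by (rule finite_vimageI) (auto simp: fin inj_on_def)
    then show "finite {i. 3 * i + r \<in> G}"
      by (simp add: vimage_def)
    show "i \<in> {i. 3 * i + r \<in> G}" if "Suc i \<in> {i. 3 * i + r \<in> G}" for i
      using down[of "3 * i + r"] that by (simp add: algebra_simps)
  qed blast
  obtain a b where a: "{i. 3 * i + 1 \<in> G} = {..<a}" and b: "{i. 3 * i + 2 \<in> G} = {..<b}"
    using initial by meson
  have eq: "x \<in> G \<longleftrightarrow> x \<in> kunz_gaps a b" for x
  proof -
    define i where "i = x div 3"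
    have "x = 3 * i \<or> x = 3 * i + 1 \<or> x = 3 * i + 2"
      unfolding i_def by presburger
    moreover have "3 * i + 1 \<in> G \<longleftrightarrow> i < a" "3 * i + 2 \<in> G \<longleftrightarrow> i < b"
      using a b by blast+
    ultimately show ?thesis
      using \<open>3 * i \<notin> G\<close> mem_kunz_gaps_add by metis
  qed
  moreover have "1 \<le> a" "1 \<le> b"
    using small[of 1] small[of 2] eq by (auto simp: mem_kunz_gaps)
  ultimately show thesis
    using that by blast
qed

lemma gapsets_3_eq:
  "gapsets g q 3 = (\<lambda>(a, b). kunz_gaps a b) `
     {(a, b). 1 \<le> a \<and> 1 \<le> b \<and> b \<le> 2 * a \<and> a \<le> 2 * b + 1 \<and> a + b = g \<and> max a b = q}"
    (is "_ = ?f ` ?P")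
proof
  show "gapsets g q 3 \<subseteq> ?f ` ?P"
  proof
    fix G assume G: "G \<in> gapsets g q 3"
    then obtain a b where ab: "1 \<le> a" "1 \<le> b" "G = kunz_gaps a b"
      unfolding gapsets_def using gapset_multiplicity_3E by blast
    with G have "(a, b) \<in> ?P"
      by (auto simp: gapsets_def genus_def card_kunz_gaps depth_kunz_gaps gapset_kunz_gaps_iff
          simp del: One_nat_def)
    with ab show "G \<in> ?f ` ?P"
      by force
  qed
  show "?f ` ?P \<subseteq> gapsets g q 3"
    by (auto simp: gapsets_def genus_def card_kunz_gaps depth_kunz_gaps gapset_kunz_gaps_iff
        multiplicity_kunz_gaps simp del: One_nat_def of_nat_max)
qed

text \<open>The larger coordinate is \<open>q\<close> and the other is \<open>g - q\<close>, whence
  \<open>g \<le> 2 * q\<close>. The remaining bound is q \<le> 2(g - q) + 1 if a = q, and q \<le>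
  2(g - q) if b = q. As \<open>g \<ge> 2\<close>, either bound gives q < g, so \<open>g - q\<close>
  is positive and not truncated.\<close>

lemma gapsets_3_explicit:
  assumes "2 \<le> g"
  shows "gapsets g q 3 =
    (if g \<le> 2 * q \<and> 3 * q \<le> 2 * g + 1 then {kunz_gaps q (g - q)} else {}) \<union>
    (if g \<le> 2 * q \<and> 3 * q \<le> 2 * g then {kunz_gaps (g - q) q} else {})"
proof -
  have "{(a, b). 1 \<le> a \<and> 1 \<le> b \<and> b \<le> 2 * a \<and> a \<le> 2 * b + 1 \<and> a + b = g \<and> max a b = q} =
    (if g \<le> 2 * q \<and> 3 * q \<le> 2 * g + 1 then {(q, g - q)} else {}) \<union>
    (if g \<le> 2 * q \<and> 3 * q \<le> 2 * g then {(g - q, q)} else {})"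
    using assms by (auto simp: max_def split: if_splits)
  then show ?thesis
    unfolding gapsets_3_eq by (simp add: image_Un)
qed

theorem theorem7p1:
  fixes g q :: nat
  assumes "g \<ge> 2" and "q \<ge> 1"
  shows "finite (gapsets g q 3) \<and>
    (real q < real g / 2 \<longrightarrow> card (gapsets g q 3) = 0) \<and>
    (real q = real g / 2 \<longrightarrow> card (gapsets g q 3) = 1) \<and>
    ((real g + 1) / 2 \<le> real q \<and> real q \<le> 2 * real g / 3 \<longrightarrow> card (gapsets g q 3) = 2) \<and>
    (real q = (2 * real g + 1) / 3 \<longrightarrow> card (gapsets g q 3) = 1) \<and>
    (real q > (2 * real g + 1) / 3 \<longrightarrow> card (gapsets g q 3) = 0)"
proof -
  have "real q < real g / 2 \<longleftrightarrow> 2 * q < g" "real q = real g / 2 \<longleftrightarrow> 2 * q = g"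
    "(real g + 1) / 2 \<le> real q \<longleftrightarrow> g + 1 \<le> 2 * q" "real q \<le> 2 * real g / 3 \<longleftrightarrow> 3 * q \<le> 2 * g"
    "real q = (2 * real g + 1) / 3 \<longleftrightarrow> 3 * q = 2 * g + 1"
    "real q > (2 * real g + 1) / 3 \<longleftrightarrow> 3 * q > 2 * g + 1"
    unfolding of_nat_le_iff[where 'a = real, symmetric] of_nat_less_iff[where 'a = real, symmetric]
      of_nat_eq_iff[where 'a = real, symmetric] by (auto simp: field_simps)
  \<comment> \<open>The two singletons coincide exactly when 2q = g. At 3q = 2g + 1 only the one
    with a = q survives.\<close>
  then show ?thesis
    using assms unfolding gapsets_3_explicit[OF assms(1)] by auto
qed

end
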